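(* Let $D$ be an odd positive integer. Let $A$ be an integer with $1\le A\le D-1$, $A\equiv\pm1\pmod 6$ and $\gcd(D,A)=1$. Suppose that for every prime $p=p_i\in\mathcal E$ with $p_ip_{i+1}\le (3D^2-1)/2$, neither of the following holds: (a) $p\mid D$ and $A\equiv0\pmod p$; (b) $\gcd(D,p)=1$ and $AD^{-1}\bmod p\in QR_p(3)$. Then the equation $A^2+B^2+C^2=3D^2$ has a primitive solution with this value of $A$, i.e. there exist positive integers $B,C$ with $A^2+B^2+C^2=3D^2$ and $\gcd(A,B,C)=1$.
   Context: $\mathcal E=\{11,23,47,\dots\}$ is the set of primes of the form $12k-1$, enumerated in increasing order as $p_1<p_2<p_3<\cdots$, so that $p_{i+1}$ is the element of $\mathcal E$ following $p_i$. For $p\in\mathcal E$, $QR_p(3)$ denotes the set of residues $x$ modulo $p$ with $x^2\equiv3\pmod p$ (for example $QR_{11}(3)=\{5,6\}$), and $D^{-1}$ denotes the inverse of $D$ modulo $p$. Here $A$ is one of the three entries of the primitive solution, not necessarily the smallest one. *)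

theory Defs
  imports "HOL-Number_Theory.Number_Theory" "HOL-Library.Infinite_Set"
begin

definition primesE :: "nat set" where
  "primesE = {p. prime p \<and> (\<exists>k\<ge>1. p = 12 * k - 1)}"

text \<open>Indices start at 0: the prime written $p_{i+1}$ in the mathematical text is \<open>pE i\<close>.
  In particular the element of \<open>primesE\<close> following \<open>pE i\<close> is \<open>pE (Suc i)\<close>.\<close>

definition pE :: "nat \<Rightarrow> nat" where
  "pE i = enumerate primesE i"

text \<open>Residues modulo \<open>p\<close> are represented by their least nonnegative representatives.\<close>

definition QR_set :: "nat \<Rightarrow> int \<Rightarrow> int set" where
  "QR_set p a = {x. 0 \<le> x \<and> x < int p \<and> [x ^ 2 = a] (mod int p)}"

end

theory Submission
  imports Defs "HOL-Library.Discrete_Functions"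
begin

text \<open>
  Put \<open>N = 3 D\<^sup>2 - A\<^sup>2\<close>. The congruences on \<open>A\<close> and \<open>D\<close> give \<open>N = 2 M\<close> with \<open>M mod 4 = 1\<close>, and it
  suffices to write \<open>M = x\<^sup>2 + y\<^sup>2\<close>: then \<open>N = (x + y)\<^sup>2 + (x - y)\<^sup>2\<close>, neither square is zero because
  \<open>N mod 4 = 2\<close> is not a square, and a common prime factor of the three entries would have its square
  dividing \<open>3 D\<^sup>2\<close>, hence would divide both \<open>D\<close> and \<open>A\<close>.

  By the two squares theorem, \<open>M\<close> fails to be a sum of two squares only if some prime \<open>q\<close> with
  \<open>q mod 4 = 3\<close> divides it to an odd power. Since \<open>M mod 4 = 1\<close>, a single such prime is impossible,
  so there are two of them, \<open>q < r\<close>, with \<open>q r \<le> M \<le> (3 D\<^sup>2 - 1) / 2\<close>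
  (lemma \<open>two_primes_if_not_sum_of_two_squares\<close>). Modulo a prime \<open>q\<close> dividing \<open>N\<close>, the number
  \<open>A / D\<close> is a square root of \<open>3\<close>, and quadratic reciprocity forces \<open>q mod 12 = 11\<close>; thus both \<open>q\<close>
  and \<open>r\<close> belong to the enumerated set of primes (lemma \<open>mod_12_eq_11_if_QuadRes_3\<close>). The successor
  of \<open>q\<close> in that set is at most \<open>r\<close>, so the hypothesis applies to \<open>q\<close> and forbids \<open>A / D\<close> to be a
  square root of \<open>3\<close> modulo \<open>q\<close>, a contradiction.
\<close>

section \<open>Sums of two squares\<close>

text \<open>Thue's argument: with \<open>k\<^sup>2 < p < (k + 1)\<^sup>2\<close> and \<open>u\<^sup>2 \<equiv> -1\<close>, the \<open>(k + 1)\<^sup>2 > p\<close> pairs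
  \<open>(a, b)\<close> with entries in \<open>{0..k}\<close> cannot all have different values \<open>a - u b\<close> modulo \<open>p\<close>. The
  difference \<open>(a, b)\<close> of two colliding pairs is nonzero and satisfies \<open>a\<^sup>2 + b\<^sup>2 \<equiv> 0\<close>, while
  \<open>a\<^sup>2 + b\<^sup>2 \<le> 2 k\<^sup>2 < 2 p\<close>.\<close>

lemma prime_mod_4_eq_1_imp_sum_of_two_squares:
  fixes p :: nat
  assumes "prime p" and "p mod 4 = 1"
  shows "\<exists>x y :: int. int p = x\<^sup>2 + y\<^sup>2"
proof -
  have "2 < p"
    using assms prime_gt_1_nat[of p] by (cases "p = 2") auto
  have "even ((p - 1) div 2)"
    using assms(2) by presburger
  then have "[Legendre (-1) (int p) = 1] (mod int p)"
    using euler_criterion[OF assms(1) \<open>2 < p\<close>, of "-1"] by simp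
  moreover have "\<not> [-1 = 1] (mod int p)" "\<not> [0 = 1] (mod int p)"
    using \<open>2 < p\<close> by (auto simp: cong_iff_dvd_diff dest: zdvd_imp_le)
  ultimately have "QuadRes (int p) (-1)"
    by (auto simp: Legendre_def split: if_splits)
  then obtain u where u: "[u\<^sup>2 = -1] (mod int p)"
    by (auto simp: QuadRes_def)

  define k where "k = floor_sqrt p"
  have "k\<^sup>2 \<le> p" "p < (Suc k)\<^sup>2"
    by (simp_all add: k_def Suc_floor_sqrt_power2_gt)
  moreover have "k\<^sup>2 \<noteq> p"
    using assms(1) by (auto simp: prime_power_iff)
  ultimately have k: "int k ^ 2 < int p" "p < (Suc k)\<^sup>2"
    by (simp_all flip: of_nat_power)

  define S where "S = {0..int k} \<times> {0..int k}"
  define f where "f = (\<lambda>(a, b). (a - u * b) mod int p)"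
  have "f ` S \<subseteq> {0..<int p}"
    using \<open>2 < p\<close> by (auto simp: f_def)
  then have "card (f ` S) \<le> p"
    using card_mono[of "{0..<int p}"] by fastforce
  moreover have "card S = (Suc k)\<^sup>2"
    by (simp add: S_def card_cartesian_product power2_eq_square nat_add_distrib)
  ultimately have "\<not> inj_on f S"
    using k by (intro pigeonhole) auto
  then obtain a b c d where
    ab: "(a, b) \<in> S" and cd: "(c, d) \<in> S" and ne: "(a, b) \<noteq> (c, d)" and eq: "f (a, b) = f (c, d)"
    unfolding inj_on_def by (metis surj_pair)
  define x y where "x = a - c" and "y = b - d"
  have "int p dvd x - u * y"
    using eq by (simp add: f_def x_def y_def mod_eq_dvd_iff algebra_simps)
  then have "int p dvd (x - u * y) * (x + u * y) + (u\<^sup>2 + 1) * y\<^sup>2"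
    using u by (auto simp: cong_iff_dvd_diff intro: dvd_add[OF dvd_mult2 dvd_mult2])
  also have "(x - u * y) * (x + u * y) + (u\<^sup>2 + 1) * y\<^sup>2 = x\<^sup>2 + y\<^sup>2"
    by (simp add: algebra_simps power2_eq_square)
  finally obtain m where m: "x\<^sup>2 + y\<^sup>2 = int p * m" ..
  have "x\<^sup>2 \<le> (int k)\<^sup>2" "y\<^sup>2 \<le> (int k)\<^sup>2"
    using ab cd by (auto simp: S_def x_def y_def abs_le_square_iff[symmetric])
  then have "int p * m < int p * 2"
    using k(1) m by linarith
  moreover have "x\<^sup>2 + y\<^sup>2 > 0"
    using ne by (auto simp: x_def y_def sum_power2_gt_zero_iff)
  then have "int p * 0 < int p * m"
    using m by simp
  ultimately have "m = 1"
    using \<open>2 < p\<close> by (simp only: mult_less_cancel_left) auto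
  with m show ?thesis
    by (metis mult.right_neutral)
qed

lemma sum_of_two_squares_mult:
  fixes m n :: int
  assumes "\<exists>x y. m = x\<^sup>2 + y\<^sup>2" and "\<exists>x y. n = x\<^sup>2 + y\<^sup>2"
  shows "\<exists>x y. m * n = x\<^sup>2 + y\<^sup>2"
proof -
  obtain a b c d where "m = a\<^sup>2 + b\<^sup>2" "n = c\<^sup>2 + d\<^sup>2"
    using assms by blast
  then have "m * n = (a * c - b * d)\<^sup>2 + (a * d + b * c)\<^sup>2"
    by (simp add: power2_eq_square algebra_simps)
  then show ?thesis by blast
qed

text \<open>The two squares theorem. Prime factors are split off one at a time, those congruent to
  \<open>3\<close> modulo \<open>4\<close> in pairs, so that the remaining cofactor again satisfies the hypothesis.\<close>

lemma sum_of_two_squares_if_even_multiplicities: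
  fixes n :: nat
  assumes "n > 0"
    and "\<And>q. prime q \<Longrightarrow> q mod 4 = 3 \<Longrightarrow> even (multiplicity q n)"
  shows "\<exists>x y :: int. int n = x\<^sup>2 + y\<^sup>2"
  using assms
proof (induction n rule: less_induct)
  case (less n)
  show ?case
  proof (cases "n = 1")
    case True
    then have "int n = 1\<^sup>2 + 0\<^sup>2" by simp
    then show ?thesis by blast
  next
    case False
    then obtain p where p: "prime p" "p dvd n"
      using prime_factor_nat by blast
    have step: "\<exists>x y :: int. int n = x\<^sup>2 + y\<^sup>2"
      if n: "n = d * m" and "d > 1" and d: "\<exists>x y :: int. int d = x\<^sup>2 + y\<^sup>2"
        and even_d: "\<And>q. prime q \<Longrightarrow> q mod 4 = 3 \<Longrightarrow> even (multiplicity q d)" for d m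
    proof -
      have "m > 0" "d > 0"
        using \<open>n > 0\<close> n by auto
      have "even (multiplicity q m)" if q: "prime q" "q mod 4 = 3" for q
        using less.prems(2)[OF q] even_d[OF q] q(1) \<open>m > 0\<close> \<open>d > 0\<close>
        by (simp add: n prime_elem_multiplicity_mult_distrib)
      moreover have "m < n"
        using n \<open>d > 1\<close> \<open>m > 0\<close> by simp
      ultimately have "\<exists>x y :: int. int m = x\<^sup>2 + y\<^sup>2"
        using less.IH \<open>m > 0\<close> by blast
      then show ?thesis
        using sum_of_two_squares_mult[OF d] n by simp
    qed
    consider "p = 2" | "p mod 4 = 1" | "p mod 4 = 3"
    proof -
      have "p = 2 \<or> odd p"
        using p(1) primes_dvd_imp_eq two_is_prime_nat by blast
      then have "p = 2 \<or> p mod 4 = 1 \<or> p mod 4 = 3" by presburger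
      then show thesis using that by blast
    qed
    then show ?thesis
    proof cases
      case 3
      have "multiplicity p n \<noteq> 0"
        using p \<open>n > 0\<close> prime_multiplicity_gt_zero_iff[of p n] by simp
      then have "multiplicity p n \<ge> 2"
        using less.prems(2)[OF p(1) 3] by presburger
      then obtain m where "n = p\<^sup>2 * m"
        using multiplicity_dvd' by (metis dvdE)
      moreover have "int (p\<^sup>2) = (int p)\<^sup>2 + 0\<^sup>2"
        by simp
      moreover have "p\<^sup>2 > 1"
        using prime_gt_1_nat[OF p(1)] by (rule one_less_power) simp
      moreover have "even (multiplicity q (p\<^sup>2))" if "prime q" for q
        using that p(1) prime_gt_0_nat[OF p(1)]
        by (simp add: prime_elem_multiplicity_power_distrib)
      ultimately show ?thesis
        using step by metis
    next
      case 1
      have "int p = 1\<^sup>2 + 1\<^sup>2"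
        using 1 by simp
      then have "\<exists>x y :: int. int p = x\<^sup>2 + y\<^sup>2"
        by blast
      moreover obtain m where "n = p * m"
        using p(2) by blast
      moreover have "even (multiplicity q p)" if "prime q" "q mod 4 = 3" for q
        using that p(1) 1 by (auto simp: prime_multiplicity_other)
      ultimately show ?thesis
        using step prime_gt_1_nat[OF p(1)] by blast
    next
      case 2
      have "\<exists>x y :: int. int p = x\<^sup>2 + y\<^sup>2"
        using prime_mod_4_eq_1_imp_sum_of_two_squares[OF p(1) 2] .
      moreover obtain m where "n = p * m"
        using p(2) by blast
      moreover have "even (multiplicity q p)" if "prime q" "q mod 4 = 3" for q
        using that p(1) 2 by (cases "q = p") (auto simp: prime_multiplicity_other)
      ultimately show ?thesis
        using step prime_gt_1_nat[OF p(1)] by blast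
    qed
  qed
qed

lemma odd_square_mod_8:
  fixes z :: int
  assumes "odd z"
  shows "z\<^sup>2 mod 8 = 1"
proof -
  obtain w where "z = 2 * w + 1"
    using assms by (elim oddE)
  then have z: "z\<^sup>2 = 4 * (w * (w + 1)) + 1"
    by (simp add: power2_eq_square algebra_simps)
  have "even (w * (w + 1))" by simp
  then obtain v where "w * (w + 1) = 2 * v" ..
  with z have "z\<^sup>2 = 8 * v + 1" by simp
  then show ?thesis by presburger
qed

lemma odd_sum_of_two_squares_mod_4:
  fixes x y :: int
  assumes "odd (x\<^sup>2 + y\<^sup>2)"
  shows "(x\<^sup>2 + y\<^sup>2) mod 4 = 1"
proof -
  have sq: "z\<^sup>2 mod 4 = of_bool (odd z)" for z :: int
  proof (cases "even z")
    case True
    then show ?thesis by (auto elim!: evenE simp: power2_eq_square)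
  next
    case False
    have "z\<^sup>2 mod 4 = z\<^sup>2 mod 8 mod 4"
      by (simp add: mod_mod_cancel)
    then show ?thesis
      using False odd_square_mod_8[of z] by simp
  qed
  have "(x\<^sup>2 + y\<^sup>2) mod 4 = (x\<^sup>2 mod 4 + y\<^sup>2 mod 4) mod 4"
    by (rule mod_add_eq[symmetric])
  also have "\<dots> = 1"
    using assms by (auto simp: sq)
  finally show ?thesis .
qed

text \<open>If \<open>q\<close> were the only prime congruent to \<open>3\<close> modulo \<open>4\<close> of odd multiplicity, then \<open>n / q\<close>
  would be an odd sum of two squares, hence congruent to \<open>1\<close>, and \<open>n\<close> would be congruent to \<open>3\<close>.\<close>

lemma two_primes_if_not_sum_of_two_squares:
  fixes n :: nat
  assumes "n mod 4 = 1" and "\<nexists>x y :: int. int n = x\<^sup>2 + y\<^sup>2"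
  obtains q r :: nat where "prime q" "prime r" "q mod 4 = 3" "r mod 4 = 3" "q < r" "q * r dvd n"
proof -
  have "n > 0"
    using assms(1) by (cases n) auto
  obtain q where q: "prime q" "q mod 4 = 3" "odd (multiplicity q n)"
    using sum_of_two_squares_if_even_multiplicities[OF \<open>n > 0\<close>] assms(2) by blast
  then have "q dvd n"
    using not_dvd_imp_multiplicity_0 by (metis even_zero)
  then obtain m where n: "n = q * m" ..
  have "m > 0"
    using \<open>n > 0\<close> n by simp
  have "\<nexists>x y :: int. int m = x\<^sup>2 + y\<^sup>2"
  proof
    assume "\<exists>x y :: int. int m = x\<^sup>2 + y\<^sup>2"
    then obtain x y where m: "int m = x\<^sup>2 + y\<^sup>2" by blast
    have "odd n"
      using assms(1) by presburger
    then have "odd (int m)"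
      by (simp add: n)
    then have "int m mod 4 = 1"
      unfolding m by (rule odd_sum_of_two_squares_mod_4)
    then have "m mod 4 = 1" by presburger
    moreover have "n mod 4 = (q mod 4) * (m mod 4) mod 4"
      by (simp add: n mod_mult_eq)
    ultimately have "n mod 4 = 3"
      using q(2) by simp
    then show False
      using assms(1) by simp
  qed
  then obtain r where r: "prime r" "r mod 4 = 3" "odd (multiplicity r m)"
    using sum_of_two_squares_if_even_multiplicities[OF \<open>m > 0\<close>] by blast
  then have "r dvd m"
    using not_dvd_imp_multiplicity_0 by (metis even_zero)
  have "multiplicity q n = Suc (multiplicity q m)"
    using q(1) \<open>m > 0\<close> prime_gt_1_nat[OF q(1)] by (simp add: n multiplicity_times_same)
  then have "q \<noteq> r"
    using q(3) r(3) by auto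
  have "q * r dvd n" "r * q dvd n"
    using \<open>r dvd m\<close> by (simp_all add: n mult.commute)
  then show ?thesis
    using that q r \<open>q \<noteq> r\<close> by (metis linorder_neqE_nat)
qed

section \<open>The enumerated primes\<close>

text \<open>Reciprocity gives \<open>(q / 3) = -(3 / q) = -1\<close> as both primes are \<open>3\<close> modulo \<open>4\<close>, so \<open>q\<close> is not
  a square modulo \<open>3\<close>.\<close>

lemma mod_12_eq_11_if_QuadRes_3:
  fixes q :: nat
  assumes "prime q" and "q mod 4 = 3" and "q \<noteq> 3" and "QuadRes (int q) 3"
  shows "q mod 12 = 11"
proof -
  have "q > 3"
    using assms(2,3) by presburger
  then have "\<not> [3 = 0] (mod int q)"
    by (auto simp: cong_iff_dvd_diff dest: zdvd_imp_le)
  then have "Legendre 3 (int q) = 1"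
    using assms(4) by (simp add: Legendre_def)
  moreover have "odd ((q - 1) div 2)"
    using assms(2) by presburger
  then have "Legendre (int 3) (int q) * Legendre (int q) (int 3) = -1"
    using Quadratic_Reciprocity[of 3 q] \<open>q > 3\<close> assms(1) by simp
  ultimately have L: "Legendre (int q) 3 = -1"
    by simp
  have "q mod 3 \<noteq> 0"
  proof
    assume "q mod 3 = 0"
    then have "int q mod 3 = 0" by presburger
    then show False using L by (simp add: Legendre_def cong_def)
  qed
  moreover have "q mod 3 \<noteq> 1"
  proof
    assume "q mod 3 = 1"
    then have "int q mod 3 = 1" by presburger
    then have "[1\<^sup>2 = int q] (mod 3)" "\<not> [int q = 0] (mod 3)"
      by (simp_all add: cong_def)
    then show False
      using L unfolding Legendre_def QuadRes_def by (metis one_neq_neg_one)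
  qed
  ultimately show ?thesis
    using assms(2) by presburger
qed

lemma primesE_iff: "p \<in> primesE \<longleftrightarrow> prime p \<and> p mod 12 = 11"
proof -
  have "(\<exists>k\<ge>1. p = 12 * k - 1) \<longleftrightarrow> p mod 12 = 11"
  proof
    assume "\<exists>k\<ge>1. p = 12 * k - 1"
    then obtain k where "k \<ge> 1" "p = 12 * k - 1" by blast
    then have "p = 12 * (k - 1) + 11" by simp
    then show "p mod 12 = 11" by simp
  next
    assume "p mod 12 = 11"
    then have "p = 12 * (p div 12 + 1) - 1"
      using div_mult_mod_eq[of p 12] by simp
    then show "\<exists>k\<ge>1. p = 12 * k - 1"
      by (intro exI[of _ "p div 12 + 1"]) simp
  qed
  then show ?thesis by (simp add: primesE_def)
qed

lemma enumerate_successor_le: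
  fixes S :: "nat set"
  assumes "q \<in> S" and "r \<in> S" and "q < r"
  shows "\<exists>i. enumerate S i = q \<and> enumerate S (Suc i) \<le> r"
proof (cases "finite S")
  case True
  then obtain i j where ij: "i < card S" "enumerate S i = q" "j < card S" "enumerate S j = r"
    using assms finite_enumerate_Ex by metis
  then have "i < j"
    using assms(3) finite_enumerate_mono_iff[OF True] by blast
  then have "enumerate S (Suc i) \<le> enumerate S j"
    using finite_enumerate_mono[OF _ True, of "Suc i" j] ij(3)
    by (cases "Suc i = j") auto
  with ij show ?thesis by blast
next
  case False
  then obtain i j where ij: "enumerate S i = q" "enumerate S j = r"
    using assms enumerate_Ex by metis
  then have "i < j"
    using assms(3) enumerate_mono_iff[OF False] by blast
  then have "enumerate S (Suc i) \<le> enumerate S j"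
    using enumerate_mono_le_iff[OF False] by simp
  with ij show ?thesis by blast
qed

section \<open>Primitive solutions\<close>

text \<open>Divide the congruence \<open>A\<^sup>2 \<equiv> a D\<^sup>2\<close> by \<open>D\<^sup>2\<close>.\<close>

lemma quotient_in_QR_set:
  fixes A D a :: int
  assumes "q > 0" and "coprime (int q) D" and "int q dvd a * D\<^sup>2 - A\<^sup>2"
  shows "(A * modular_inverse (int q) D) mod int q \<in> QR_set q a"
proof -
  define E where "E = modular_inverse (int q) D"
  have "[D * E = 1] (mod int q)"
    unfolding E_def using assms(2) by (intro cong_modular_inverse1) (simp add: coprime_commute)
  then have "[(D * E)\<^sup>2 = 1\<^sup>2] (mod int q)"
    by (rule cong_pow)
  then have "[a * (D * E)\<^sup>2 = a * 1] (mod int q)"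
    by (intro cong_mult) simp_all
  moreover have "[A\<^sup>2 * E\<^sup>2 = a * D\<^sup>2 * E\<^sup>2] (mod int q)"
    using assms(3) by (intro cong_mult cong_refl) (simp add: cong_iff_dvd_diff dvd_diff_commute)
  ultimately have "[(A * E)\<^sup>2 = a] (mod int q)"
    by (simp add: power_mult_distrib mult.assoc) (metis cong_trans)
  then show ?thesis
    using assms(1) by (simp add: QR_set_def E_def cong_def power_mod)
qed

theorem theorem3p3:
  fixes D A :: int
  assumes "D > 0" and "odd D"
    and "1 \<le> A" and "A \<le> D - 1"
    and "[A = 1] (mod 6) \<or> [A = -1] (mod 6)"
    and "gcd D A = 1"
    and "\<And>i. real (pE i * pE (Suc i)) \<le> (3 * real_of_int D ^ 2 - 1) / 2 \<Longrightarrow>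
           \<not> (int (pE i) dvd D \<and> [A = 0] (mod int (pE i))) \<and>
           \<not> (gcd D (int (pE i)) = 1 \<and>
              (A * modular_inverse (int (pE i)) D) mod int (pE i) \<in> QR_set (pE i) 3)"
  shows "\<exists>B C :: int. B > 0 \<and> C > 0 \<and> A ^ 2 + B ^ 2 + C ^ 2 = 3 * D ^ 2 \<and> Gcd {A, B, C} = 1"
proof -
  have "A mod 6 = 1 \<or> A mod 6 = 5"
    using assms(5) by (auto simp: cong_def)
  then have "odd A" and "\<not> 3 dvd A"
    by presburger+
  define N where "N = 3 * D\<^sup>2 - A\<^sup>2"
  have "A\<^sup>2 < D\<^sup>2"
    using assms(3,4) by (intro power_strict_mono) auto
  have "N mod 8 = 2"
    using odd_square_mod_8[OF \<open>odd D\<close>] odd_square_mod_8[OF \<open>odd A\<close>] unfolding N_def by presburger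
  define M where "M = nat (N div 2)"
  have "N > 0"
    using \<open>A\<^sup>2 < D\<^sup>2\<close> by (simp add: N_def) (smt (verit) zero_le_power2)
  then have "int M = N div 2"
    by (simp add: M_def)
  then have M: "N = 2 * int M" "M mod 4 = 1"
    using \<open>N mod 8 = 2\<close> \<open>int M = N div 2\<close> by presburger+

  \<comment> \<open>A prime dividing both \<open>N\<close> and \<open>D\<close> would divide \<open>A\<close>; and \<open>3\<close> dividing \<open>N\<close> would divide \<open>A\<close>.\<close>
  have prime_dvd_M: "coprime (int q) D" "q \<noteq> 3" if q: "prime q" "q dvd M" for q
  proof -
    have "int q dvd N"
      using q(2) M(1) by simp
    have "prime (int q)"
      using q(1) by simp
    show "coprime (int q) D"
    proof (rule prime_imp_coprime[OF \<open>prime (int q)\<close>])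
      show "\<not> int q dvd D"
      proof
        assume "int q dvd D"
        then have "int q dvd 3 * D\<^sup>2 - N"
          using \<open>int q dvd N\<close> by (simp add: power2_eq_square)
        then have "int q dvd A"
          using prime_dvd_power[OF \<open>prime (int q)\<close>] by (simp add: N_def)
        with \<open>int q dvd D\<close> have "int q dvd 1"
          using assms(6) by (metis gcd_greatest)
        then show False
          using \<open>prime (int q)\<close> not_prime_unit by blast
      qed
    qed
    show "q \<noteq> 3"
    proof
      assume "q = 3"
      then have "3 dvd 3 * D\<^sup>2 - N"
        using \<open>int q dvd N\<close> by (intro dvd_diff) simp_all
      then have "3 dvd A"
        using prime_dvd_power[of "3 :: int" A 2] by (simp add: N_def)
      with \<open>\<not> 3 dvd A\<close> show False ..
    qed
  qed
  have QR: "(A * modular_inverse (int q) D) mod int q \<in> QR_set q 3" if q: "prime q" "q dvd M" for q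
  proof (rule quotient_in_QR_set)
    show "int q dvd 3 * D\<^sup>2 - A\<^sup>2"
      using q(2) M(1) by (simp add: N_def)
  qed (use q prime_dvd_M prime_gt_0_nat in auto)
  have in_primesE: "q \<in> primesE" if q: "prime q" "q dvd M" "q mod 4 = 3" for q
  proof -
    have "QuadRes (int q) 3"
      using QR[OF q(1,2)] by (auto simp: QR_set_def QuadRes_def)
    then show ?thesis
      using q prime_dvd_M(2) mod_12_eq_11_if_QuadRes_3 by (simp add: primesE_iff)
  qed

  have "\<exists>x y :: int. int M = x\<^sup>2 + y\<^sup>2"
  proof (rule ccontr)
    assume "\<not> ?thesis"
    then obtain q r where qr: "prime q" "prime r" "q mod 4 = 3" "r mod 4 = 3" "q < r" "q * r dvd M"
      using two_primes_if_not_sum_of_two_squares[OF M(2)] by metis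
    then have dvd: "q dvd M" "r dvd M"
      by (auto dest: dvd_mult_left dvd_mult_right)
    obtain i where i: "pE i = q" "pE (Suc i) \<le> r"
      using enumerate_successor_le[of q primesE r] in_primesE qr dvd by (auto simp: pE_def)
    have "M > 0"
      using M(1) \<open>N > 0\<close> by simp
    then have "pE i * pE (Suc i) \<le> M"
      using i qr(6) by (metis dvd_imp_le le_trans mult_le_mono2)
    moreover have "2 * int M \<le> 3 * D\<^sup>2 - 1"
      using M(1) one_le_power[OF assms(3), of 2] unfolding N_def by linarith
    then have "2 * real M \<le> 3 * real_of_int D ^ 2 - 1"
      by (metis (mono_tags, lifting) of_int_1 of_int_diff of_int_le_iff of_int_mult
          of_int_numeral of_int_of_nat_eq of_int_power)
    ultimately have "real (pE i * pE (Suc i)) \<le> (3 * real_of_int D ^ 2 - 1) / 2"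
      by (simp only: of_nat_le_iff[where 'a = real, symmetric]) simp
    then have "\<not> (gcd D (int q) = 1 \<and> (A * modular_inverse (int q) D) mod int q \<in> QR_set q 3)"
      unfolding i(1)[symmetric] by (rule conjunct2[OF assms(7)])
    moreover have "gcd D (int q) = 1"
      using prime_dvd_M(1)[OF qr(1) dvd(1)] by (simp add: coprime_commute)
    ultimately show False
      using QR[OF qr(1) dvd(1)] by blast
  qed
  then obtain x y where xy: "int M = x\<^sup>2 + y\<^sup>2" by blast
  define B C where "B = \<bar>x + y\<bar>" and "C = \<bar>x - y\<bar>"
  have "odd (x\<^sup>2 + y\<^sup>2)"
    using M(2) unfolding xy[symmetric] by presburger
  then have "odd (x + y)" "odd (x - y)"
    by simp_all
  then have "x + y \<noteq> 0" "x - y \<noteq> 0"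
    by (metis even_zero)+
  then have "B > 0" "C > 0"
    by (auto simp: B_def C_def)
  have sum: "A\<^sup>2 + B\<^sup>2 + C\<^sup>2 = 3 * D\<^sup>2"
    using M(1) xy by (simp add: B_def C_def N_def power2_eq_square algebra_simps)
  \<comment> \<open>If a prime \<open>p\<close> divides all three entries, then \<open>p\<^sup>2\<close> divides \<open>3 D\<^sup>2\<close>, so \<open>p\<close> divides \<open>D\<close>.\<close>
  have "Gcd {A, B, C} = 1"
  proof -
    define g where "g = Gcd {A, B, C}"
    have g: "g dvd A" "g dvd B" "g dvd C"
      unfolding g_def by (rule Gcd_dvd; simp)+
    have "is_unit g"
    proof (rule ccontr)
      assume "\<not> is_unit g"
      moreover have "g \<noteq> 0"
        using g(1) assms(3) by auto
      ultimately obtain p where p: "prime p" "p dvd g"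
        using prime_divisor_exists by blast
      have "p\<^sup>2 dvd A\<^sup>2 + B\<^sup>2 + C\<^sup>2"
        using g p(2) by (intro dvd_add) (auto intro: dvd_trans)
      then have "p * p dvd 3 * D\<^sup>2"
        using sum by (simp add: power2_eq_square)
      have "\<not> p dvd 3"
      proof
        assume "p dvd 3"
        then have "p = 3"
          using p(1) primes_dvd_imp_eq[of p 3] by simp
        then show False
          using p(2) g(1) \<open>\<not> 3 dvd A\<close> by (metis dvd_trans)
      qed
      then have "p dvd D"
        using \<open>p * p dvd 3 * D\<^sup>2\<close> p(1) by (metis dvd_mult_left prime_dvd_mult_iff prime_dvd_power)
      moreover have "p dvd A"
        using p(2) g(1) by (rule dvd_trans)
      ultimately have "p dvd 1"
        using assms(6) by (metis gcd_greatest)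
      then show False
        using p(1) not_prime_unit by blast
    qed
    then show ?thesis
      by (simp add: g_def)
  qed
  with \<open>B > 0\<close> \<open>C > 0\<close> sum show ?thesis by blast
qed

end
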